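(* Let $k\ge 1$ be an integer. If $G$ is a graph of order at least $k$, then $L_k(G)+L_k(\overline{G})\geq 2k$. Moreover, $L_k(G)+L_k(\overline{G})=2k$ if and only if $G$ has one of the following properties: (i) $G$ has exactly $k$ vertices; (ii) for each $(k+1)$-subset $X$ of $V(G)$, at least one of the following holds: (a) $G[X]$ has maximum degree $k$ and there is a vertex outside $X$ that is not adjacent to any vertex of $X$; (b) there is a vertex outside $X$ that is adjacent to all the vertices of $X$, and $G[X]$ has an isolated vertex; (c) there are a vertex outside $X$ that is adjacent to all the vertices of $X$ and another vertex outside $X$ that is not adjacent to any vertex of $X$.
   Context: All graphs are finite, undirected, simple and nontrivial (at least two vertices). $\overline{G}$ is the complement of $G$, $G[X]$ the subgraph induced by $X$, and $N[v]=\{v\}\cup N(v)$ the closed neighbourhood of $v$. For an integer $k\ge 1$, a set $B\subseteq V(G)$ is a $k$-limited packing if $|N[v]\cap B|\le k$ for every vertex $v$ of $G$; $L_k(G)$ is the maximum cardinality of a $k$-limited packing in $G$. When (ii) is considered, $G$ has order at least $k+1$ (so that there are $(k+1)$-subsets). *)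

theory Defs
  imports Main "Graph_Theory.Graph_Theory"
begin

text \<open>
  A simple undirected graph is a \<^locale>\<open>graph\<close>: a finite, loop-free, symmetric digraph without
  parallel arcs. An edge \<open>uv\<close> is represented by the two arcs \<open>u \<rightarrow> v\<close> and \<open>v \<rightarrow> u\<close>, so the
  out-degree of a vertex is its degree as a vertex of the undirected graph.
\<close>

definition complement :: "('a, 'b) pre_digraph \<Rightarrow> ('a, 'a \<times> 'a) pre_digraph" where
  "complement G = with_proj \<lparr> pverts = verts G,
     parcs = {(u, v). u \<in> verts G \<and> v \<in> verts G \<and> u \<noteq> v \<and> \<not> u \<rightarrow>\<^bsub>G\<^esub> v} \<rparr>"

definition closed_nbhd :: "('a, 'b) pre_digraph \<Rightarrow> 'a \<Rightarrow> 'a set" where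
  "closed_nbhd G v = insert v {u \<in> verts G. v \<rightarrow>\<^bsub>G\<^esub> u}"

definition limited_packing :: "nat \<Rightarrow> ('a, 'b) pre_digraph \<Rightarrow> 'a set \<Rightarrow> bool" where
  "limited_packing k G B \<longleftrightarrow>
     B \<subseteq> verts G \<and> (\<forall>v \<in> verts G. card (closed_nbhd G v \<inter> B) \<le> k)"

definition limited_packing_number :: "nat \<Rightarrow> ('a, 'b) pre_digraph \<Rightarrow> nat" where
  "limited_packing_number k G = Max (card ` {B. limited_packing k G B})"

text \<open>Meaningful only for a finite graph with at least one vertex.\<close>

definition max_degree :: "('a, 'b) pre_digraph \<Rightarrow> nat" where
  "max_degree G = Max (out_degree G ` verts G)"

definition isolated_vertex :: "('a, 'b) pre_digraph \<Rightarrow> 'a \<Rightarrow> bool" where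
  "isolated_vertex G v \<longleftrightarrow> v \<in> verts G \<and> out_degree G v = 0"

lemma dominates_complement_iff:
  "u \<rightarrow>\<^bsub>complement G\<^esub> v \<longleftrightarrow>
     u \<in> verts G \<and> v \<in> verts G \<and> u \<noteq> v \<and> \<not> u \<rightarrow>\<^bsub>G\<^esub> v"
  by (simp add: complement_def)

lemma graph_complement:
  assumes "graph G"
  shows "graph (complement G)"
proof -
  interpret graph G by fact
  let ?A = "{(u, v). u \<in> verts G \<and> v \<in> verts G \<and> u \<noteq> v \<and> \<not> u \<rightarrow>\<^bsub>G\<^esub> v}"
  have "?A \<subseteq> verts G \<times> verts G" by auto
  then have "finite ?A" by (rule finite_subset) simp
  moreover have "sym ?A"
    using arcs_ends_symmetric[OF sym_arcs] by (auto simp: sym_def)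
  ultimately have "pair_graph \<lparr> pverts = verts G, parcs = ?A \<rparr>"
    by unfold_locales (auto simp: symmetric_def)
  then show ?thesis
    unfolding complement_def by (rule pair_graph.pair_graphD_graph)
qed

end

theory Submission
  imports Defs
begin

text \<open>
  Every \<open>k\<close>-subset of the vertices is a \<open>k\<close>-limited packing and packings are closed under subsets, so
  \<open>L\<^sub>k(G) + L\<^sub>k(G\<^sup>c) = 2k\<close> says that no \<open>(k+1)\<close>-subset \<open>X\<close> is a packing of \<open>G\<close> or of its complement
  \<open>G\<^sup>c\<close>. The set \<open>X\<close> fails to be a packing of \<open>G\<close> precisely if it lies in a closed neighbourhood \<open>N[v]\<close>,
  which means that \<open>v \<in> X\<close> has degree \<open>k\<close> in \<open>G[X]\<close>, or that \<open>v \<notin> X\<close> is adjacent to all of \<open>X\<close>; in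
  the complement, that \<open>v \<in> X\<close> is isolated in \<open>G[X]\<close>, or that \<open>v \<notin> X\<close> is adjacent to none of \<open>X\<close>.
  A vertex adjacent to all others and an isolated one do not coexist in \<open>G[X]\<close>, as \<open>X\<close> has at least
  two elements; the other three combinations are the conditions (a), (b), (c).
\<close>

lemma verts_complement [simp]: "verts (complement G) = verts G"
  by (simp add: complement_def)

lemma limited_packing_subset:
  assumes "finite (verts G)" "limited_packing k G B" "A \<subseteq> B"
  shows "limited_packing k G A"
proof -
  have "card (closed_nbhd G v \<inter> A) \<le> card (closed_nbhd G v \<inter> B)" for v
    using assms by (intro card_mono) (auto simp: limited_packing_def dest: finite_subset)
  then show ?thesis
    using assms unfolding limited_packing_def by (meson order_trans)
qed

lemma limited_packing_if_card_le:
  assumes "finite (verts G)" "B \<subseteq> verts G" "card B \<le> k"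
  shows "limited_packing k G B"
proof -
  have "card (closed_nbhd G v \<inter> B) \<le> card B" for v
    using assms by (intro card_mono) (auto dest: finite_subset)
  then show ?thesis
    using assms unfolding limited_packing_def by (meson order_trans)
qed

text \<open>The maximum runs over a finite family that contains the empty packing, so it is
  attained. A packing of size at least \<open>m\<close> can be thinned to size exactly
  \<open>m\<close>, since subsets of packings are packings.\<close>

lemma le_limited_packing_number_iff:
  assumes "finite (verts G)"
  shows "m \<le> limited_packing_number k G \<longleftrightarrow> (\<exists>B. limited_packing k G B \<and> card B = m)"
proof -
  let ?P = "{B. limited_packing k G B}"
  have "finite ?P"
    by (rule finite_subset[of _ "Pow (verts G)"]) (use assms in \<open>auto simp: limited_packing_def\<close>)
  moreover have "{} \<in> ?P"
    using assms by (simp add: limited_packing_if_card_le)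
  ultimately have "m \<le> limited_packing_number k G \<longleftrightarrow> (\<exists>B. limited_packing k G B \<and> m \<le> card B)"
    unfolding limited_packing_number_def by (subst Max_ge_iff) auto
  also have "\<dots> \<longleftrightarrow> (\<exists>B. limited_packing k G B \<and> card B = m)"
    by (meson assms limited_packing_subset obtain_subset_with_card_n order_refl)
  finally show ?thesis .
qed

lemma limited_packing_number_ge:
  assumes "finite (verts G)" "k \<le> card (verts G)"
  shows "k \<le> limited_packing_number k G"
  using assms
  by (metis le_limited_packing_number_iff limited_packing_if_card_le obtain_subset_with_card_n order_refl)

lemma limited_packing_Suc_card_iff:
  assumes "finite (verts G)" "X \<subseteq> verts G" "card X = k + 1"
  shows "limited_packing k G X \<longleftrightarrow> (\<forall>v \<in> verts G. \<not> X \<subseteq> closed_nbhd G v)"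
proof -
  have fin: "finite X"
    using assms finite_subset by blast
  have "card (closed_nbhd G v \<inter> X) \<le> k \<longleftrightarrow> \<not> X \<subseteq> closed_nbhd G v" for v
  proof
    assume "card (closed_nbhd G v \<inter> X) \<le> k"
    then show "\<not> X \<subseteq> closed_nbhd G v"
      using assms(3) by (auto simp: inf_absorb2)
  next
    assume "\<not> X \<subseteq> closed_nbhd G v"
    then have "card (closed_nbhd G v \<inter> X) < card X"
      using fin by (intro psubset_card_mono) auto
    then show "card (closed_nbhd G v \<inter> X) \<le> k"
      using assms(3) by simp
  qed
  then show ?thesis
    using assms(2) by (simp add: limited_packing_def)
qed

text \<open>The value is never below \<open>k\<close>, so equality means that \<open>k + 1\<close>
  is not reached. Excluding packings of size exactly \<open>k + 1\<close> also excludes all larger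
  ones, by thinning.\<close>

lemma limited_packing_number_eq_iff:
  assumes "finite (verts G)" "k \<le> card (verts G)"
  shows "limited_packing_number k G = k \<longleftrightarrow>
    (\<forall>X. X \<subseteq> verts G \<and> card X = k + 1 \<longrightarrow> (\<exists>v \<in> verts G. X \<subseteq> closed_nbhd G v))"
proof -
  have "limited_packing_number k G = k \<longleftrightarrow> \<not> k + 1 \<le> limited_packing_number k G"
    using limited_packing_number_ge[OF assms] by linarith
  also have "\<dots> \<longleftrightarrow> (\<forall>X. card X = k + 1 \<longrightarrow> \<not> limited_packing k G X)"
    using le_limited_packing_number_iff[OF assms(1)] by blast
  also have "\<dots> \<longleftrightarrow> (\<forall>X. X \<subseteq> verts G \<and> card X = k + 1 \<longrightarrow> \<not> limited_packing k G X)"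
    by (auto simp: limited_packing_def)
  also have "\<dots> \<longleftrightarrow> (\<forall>X. X \<subseteq> verts G \<and> card X = k + 1 \<longrightarrow> (\<exists>v \<in> verts G. X \<subseteq> closed_nbhd G v))"
    using limited_packing_Suc_card_iff[OF assms(1)] by blast
  finally show ?thesis .
qed

text \<open>\<open>out_degree\<close> counts arcs. Without parallel arcs, mapping an arc to its head
  is injective, so the arcs leaving \<open>v\<close> can be counted as neighbours.\<close>

lemma (in digraph) out_degree_induce_subgraph:
  assumes "v \<in> X"
  shows "out_degree (G \<restriction> X) v = card {u \<in> X. v \<rightarrow>\<^bsub>G\<^esub> u}"
proof -
  have "inj_on (head G) (out_arcs (G \<restriction> X) v)"
    by (auto simp: inj_on_def arc_to_ends_def intro: no_multi_arcs)
  moreover have "head G ` out_arcs (G \<restriction> X) v = {u \<in> X. v \<rightarrow>\<^bsub>G\<^esub> u}"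
    using assms by (auto simp: arcs_ends_conv)
  ultimately show ?thesis
    unfolding out_degree_def by (metis card_image)
qed

lemma (in digraph) isolated_vertex_induce_subgraph_iff:
  assumes "X \<subseteq> verts G"
  shows "isolated_vertex (G \<restriction> X) v \<longleftrightarrow> v \<in> X \<and> X \<subseteq> closed_nbhd (complement G) v"
proof -
  have "finite X"
    using assms finite_subset finite_verts by blast
  \<comment> \<open>Finiteness matters here: only for a finite set does cardinality 0 mean
    emptiness.\<close>
  then have "isolated_vertex (G \<restriction> X) v \<longleftrightarrow> v \<in> X \<and> (\<forall>u \<in> X. \<not> v \<rightarrow>\<^bsub>G\<^esub> u)"
    by (auto simp: isolated_vertex_def out_degree_induce_subgraph)
  also have "\<dots> \<longleftrightarrow> v \<in> X \<and> X \<subseteq> closed_nbhd (complement G) v"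
    using assms adj_not_same[of v] by (auto simp: closed_nbhd_def dominates_complement_iff subset_iff)
  finally show ?thesis .
qed

text \<open>A vertex of \<open>X\<close> has only \<open>k\<close> other vertices of
  \<open>X\<close> as possible neighbours. So \<open>k\<close> bounds all degrees, and a vertex
  attains it exactly when it is adjacent to the whole rest of \<open>X\<close>.\<close>

lemma (in digraph) max_degree_induce_subgraph_iff:
  assumes "X \<subseteq> verts G" "card X = k + 1"
  shows "max_degree (G \<restriction> X) = k \<longleftrightarrow> (\<exists>v \<in> X. X \<subseteq> closed_nbhd G v)"
proof -
  have fin: "finite X"
    using assms finite_subset finite_verts by blast
  have le: "out_degree (G \<restriction> X) v \<le> k"
    and eq: "out_degree (G \<restriction> X) v = k \<longleftrightarrow> X \<subseteq> closed_nbhd G v" if "v \<in> X" for v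
  proof -
    have sub: "{u \<in> X. v \<rightarrow>\<^bsub>G\<^esub> u} \<subseteq> X - {v}"
      by (auto dest: adj_not_same)
    have card: "card (X - {v}) = k"
      using that assms fin by simp
    show "out_degree (G \<restriction> X) v \<le> k"
      using card_mono[OF _ sub] fin card that by (simp add: out_degree_induce_subgraph)
    have "{u \<in> X. v \<rightarrow>\<^bsub>G\<^esub> u} = X - {v} \<longleftrightarrow> card {u \<in> X. v \<rightarrow>\<^bsub>G\<^esub> u} = k"
      using card_subset_eq[OF finite_Diff[OF fin] sub] card by argo
    then have "out_degree (G \<restriction> X) v = k \<longleftrightarrow> {u \<in> X. v \<rightarrow>\<^bsub>G\<^esub> u} = X - {v}"
      by (simp only: out_degree_induce_subgraph[OF that])
    also have "\<dots> \<longleftrightarrow> X \<subseteq> closed_nbhd G v"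
      using sub assms(1) unfolding closed_nbhd_def by blast
    finally show "out_degree (G \<restriction> X) v = k \<longleftrightarrow> X \<subseteq> closed_nbhd G v" .
  qed
  have "X \<noteq> {}"
    using assms(2) by auto
  then have "max_degree (G \<restriction> X) = k \<longleftrightarrow> (\<exists>v \<in> X. out_degree (G \<restriction> X) v = k)"
    unfolding max_degree_def using fin le by (subst Max_eq_iff) auto
  with eq show ?thesis by blast
qed

lemma (in graph) closed_nbhds_cover_iff:
  assumes "k \<ge> 1" "X \<subseteq> verts G" "card X = k + 1"
  shows "(\<exists>v \<in> verts G. X \<subseteq> closed_nbhd G v) \<and> (\<exists>v \<in> verts G. X \<subseteq> closed_nbhd (complement G) v) \<longleftrightarrow>
    (max_degree (G \<restriction> X) = k \<and> (\<exists>w \<in> verts G - X. \<forall>x \<in> X. \<not> w \<rightarrow>\<^bsub>G\<^esub> x)) \<or>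
    ((\<exists>w \<in> verts G - X. \<forall>x \<in> X. w \<rightarrow>\<^bsub>G\<^esub> x) \<and> (\<exists>x. isolated_vertex (G \<restriction> X) x)) \<or>
    (\<exists>u \<in> verts G - X. \<exists>w \<in> verts G - X. u \<noteq> w \<and> (\<forall>x \<in> X. u \<rightarrow>\<^bsub>G\<^esub> x) \<and> (\<forall>x \<in> X. \<not> w \<rightarrow>\<^bsub>G\<^esub> x))"
proof -
  obtain x\<^sub>0 where "x\<^sub>0 \<in> X"
    using assms(3) by fastforce
  have outside: "X \<subseteq> closed_nbhd G v \<longleftrightarrow> (\<forall>x \<in> X. v \<rightarrow>\<^bsub>G\<^esub> x)"
    and outside_compl: "X \<subseteq> closed_nbhd (complement G) v \<longleftrightarrow> (\<forall>x \<in> X. \<not> v \<rightarrow>\<^bsub>G\<^esub> x)"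
    if "v \<in> verts G - X" for v
    using that assms(2) by (auto simp: closed_nbhd_def dominates_complement_iff)
  \<comment> \<open>If \<open>u\<close> and \<open>w\<close> differ, the pair would be both an edge
    and a non-edge. If they coincide, every other element of \<open>X\<close> would be both a
    neighbour and a non-neighbour of \<open>u\<close>, so \<open>X\<close> would have a single
    element, against \<open>k \<ge> 1\<close>.\<close>
  have clash: "\<not> (X \<subseteq> closed_nbhd G u \<and> X \<subseteq> closed_nbhd (complement G) w)" if "u \<in> X" "w \<in> X" for u w
  proof
    assume sub: "X \<subseteq> closed_nbhd G u \<and> X \<subseteq> closed_nbhd (complement G) w"
    have "u = w"
    proof (rule ccontr)
      assume "u \<noteq> w"
      then have "u \<rightarrow>\<^bsub>G\<^esub> w" "\<not> w \<rightarrow>\<^bsub>G\<^esub> u"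
        using sub that by (auto simp: closed_nbhd_def dominates_complement_iff)
      then show False
        using arcs_ends_symmetric[OF sym_arcs] by blast
    qed
    then have "X \<subseteq> {u}"
      using sub by (auto simp: closed_nbhd_def dominates_complement_iff)
    then show False
      using assms(1,3) card_mono[of "{u}" X] by simp
  qed
  have split: "(\<exists>v \<in> verts G. P v) \<longleftrightarrow> (\<exists>v \<in> X. P v) \<or> (\<exists>v \<in> verts G - X. P v)" for P
    using assms(2) by blast
  have "(\<exists>v \<in> verts G. X \<subseteq> closed_nbhd G v) \<longleftrightarrow>
      max_degree (G \<restriction> X) = k \<or> (\<exists>v \<in> verts G - X. \<forall>x \<in> X. v \<rightarrow>\<^bsub>G\<^esub> x)"
    unfolding split max_degree_induce_subgraph_iff[OF assms(2,3)] using outside by blast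
  moreover have "(\<exists>v \<in> verts G. X \<subseteq> closed_nbhd (complement G) v) \<longleftrightarrow>
      (\<exists>x. isolated_vertex (G \<restriction> X) x) \<or> (\<exists>v \<in> verts G - X. \<forall>x \<in> X. \<not> v \<rightarrow>\<^bsub>G\<^esub> x)"
    unfolding split isolated_vertex_induce_subgraph_iff[OF assms(2)] using outside_compl by blast
  moreover have "\<not> (max_degree (G \<restriction> X) = k \<and> (\<exists>x. isolated_vertex (G \<restriction> X) x))"
    unfolding max_degree_induce_subgraph_iff[OF assms(2,3)] isolated_vertex_induce_subgraph_iff[OF assms(2)]
    using clash by blast
  \<comment> \<open>The two outside vertices are automatically distinct: one is adjacent to
    \<open>x\<^sub>0\<close>, the other is not.\<close>
  moreover have "(\<exists>v \<in> verts G - X. \<forall>x \<in> X. v \<rightarrow>\<^bsub>G\<^esub> x) \<and> (\<exists>v \<in> verts G - X. \<forall>x \<in> X. \<not> v \<rightarrow>\<^bsub>G\<^esub> x) \<longleftrightarrow>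
      (\<exists>u \<in> verts G - X. \<exists>w \<in> verts G - X. u \<noteq> w \<and> (\<forall>x \<in> X. u \<rightarrow>\<^bsub>G\<^esub> x) \<and> (\<forall>x \<in> X. \<not> w \<rightarrow>\<^bsub>G\<^esub> x))"
    using \<open>x\<^sub>0 \<in> X\<close> by (metis (no_types, lifting))
  ultimately show ?thesis by argo
qed

theorem proposition3p12:
  fixes G :: "('a, 'b) pre_digraph" and k :: nat
  assumes "graph G"
    and "card (verts G) \<ge> 2"
    and "k \<ge> 1"
    and "card (verts G) \<ge> k"
  shows "limited_packing_number k G + limited_packing_number k (complement G) \<ge> 2 * k \<and>
    (limited_packing_number k G + limited_packing_number k (complement G) = 2 * k \<longleftrightarrow>
      card (verts G) = k \<or>
      (card (verts G) \<ge> k + 1 \<and>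
       (\<forall>X. X \<subseteq> verts G \<and> card X = k + 1 \<longrightarrow>
          (max_degree (G \<restriction> X) = k \<and>
             (\<exists>w \<in> verts G - X. \<forall>x \<in> X. \<not> w \<rightarrow>\<^bsub>G\<^esub> x)) \<or>
          ((\<exists>w \<in> verts G - X. \<forall>x \<in> X. w \<rightarrow>\<^bsub>G\<^esub> x) \<and>
             (\<exists>x. isolated_vertex (G \<restriction> X) x)) \<or>
          (\<exists>u \<in> verts G - X. \<exists>w \<in> verts G - X. u \<noteq> w \<and>
             (\<forall>x \<in> X. u \<rightarrow>\<^bsub>G\<^esub> x) \<and> (\<forall>x \<in> X. \<not> w \<rightarrow>\<^bsub>G\<^esub> x)))))"
proof -
  interpret graph G by fact
  let ?L = "limited_packing_number k G" and ?L' = "limited_packing_number k (complement G)"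
  \<comment> \<open>These bounds give the inequality, and they force both numbers to equal
    \<open>k\<close> when the sum is \<open>2 * k\<close>.\<close>
  have L: "k \<le> ?L" and L': "k \<le> ?L'"
    using assms(4) by (simp_all add: limited_packing_number_ge)
  have "?L + ?L' = 2 * k \<longleftrightarrow> ?L = k \<and> ?L' = k"
    using L L' by linarith
  also have "\<dots> \<longleftrightarrow> (\<forall>X. X \<subseteq> verts G \<and> card X = k + 1 \<longrightarrow>
      (\<exists>v \<in> verts G. X \<subseteq> closed_nbhd G v) \<and> (\<exists>v \<in> verts G. X \<subseteq> closed_nbhd (complement G) v))"
    using limited_packing_number_eq_iff[of G k] limited_packing_number_eq_iff[of "complement G" k] assms(4)
    by auto
  finally have iff: "?L + ?L' = 2 * k \<longleftrightarrow> (\<forall>X. X \<subseteq> verts G \<and> card X = k + 1 \<longrightarrow>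
      (\<exists>v \<in> verts G. X \<subseteq> closed_nbhd G v) \<and> (\<exists>v \<in> verts G. X \<subseteq> closed_nbhd (complement G) v))" .
  \<comment> \<open>In order \<open>k\<close> there are no \<open>(k+1)\<close>-subsets, so the
    criterion holds trivially; this is case (i).\<close>
  have vacuous: "card X \<noteq> k + 1" if "card (verts G) = k" "X \<subseteq> verts G" for X
    using card_mono[OF finite_verts that(2)] that(1) by simp
  have "card (verts G) = k \<or> card (verts G) \<ge> k + 1"
    using assms(4) by linarith
  then have "?L + ?L' = 2 * k \<longleftrightarrow> card (verts G) = k \<or> (card (verts G) \<ge> k + 1 \<and>
      (\<forall>X. X \<subseteq> verts G \<and> card X = k + 1 \<longrightarrow>
        (\<exists>v \<in> verts G. X \<subseteq> closed_nbhd G v) \<and> (\<exists>v \<in> verts G. X \<subseteq> closed_nbhd (complement G) v)))"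
    using iff vacuous by blast
  \<comment> \<open>\<open>imp_cong\<close> makes the assumptions on \<open>X\<close> available,
    which the conditional rewriting to (a), (b), (c) requires.\<close>
  with L L' show ?thesis
    by (simp add: closed_nbhds_cover_iff[OF assms(3)] cong: imp_cong)
qed

end
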